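(* If $f\in\mathcal{S}^*_{L}$, then $f\in\Omega$ in the disc $|z|<r_0$, i.e. $|zf'(z)-f(z)|<\frac12$ for all $|z|<r_0$, where $r_0\approx0.734453$ is the positive root of $$8r\bigl(1-\sqrt{1-r}\bigr)\exp\bigl(2\sqrt{1+r}-2\bigr)-\bigl(1+\sqrt{1+r}\bigr)^2=0.$$
   Context: $\mathbb{D}=\{z\in\mathbb{C}:|z|<1\}$. $\mathcal{A}$ is the class of analytic functions $f$ on $\mathbb{D}$ with $f(0)=0$, $f'(0)=1$. $\Omega=\{f\in\mathcal{A}:|zf'(z)-f(z)|<\frac12,\ z\in\mathbb{D}\}$; "$f\in\Omega$ in the disc $|z|<r_0$" means that the defining inequality holds for all $|z|<r_0$. $\mathcal{S}^*_{L}$ is the class of $f\in\mathcal{A}$ with $zf'(z)/f(z)\prec\sqrt{1+z}$ (principal branch), where $p\prec\phi$ means $p=\phi\circ\omega$ for some analytic $\omega:\mathbb{D}\to\mathbb{D}$ with $\omega(0)=0$. *)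

theory Defs
  imports "HOL-Complex_Analysis.Complex_Analysis"
begin

abbreviation unit_disc :: "complex set" where
  "unit_disc \<equiv> ball 0 1"

definition class_A :: "(complex \<Rightarrow> complex) set" where
  "class_A = {f. f holomorphic_on unit_disc \<and> f 0 = 0 \<and> deriv f 0 = 1}"

(* Members of class_A satisfying the inequality that defines Omega in the disc |z| < r.
   The class Omega itself is Omega_in 1. *)
definition Omega_in :: "real \<Rightarrow> (complex \<Rightarrow> complex) set" where
  "Omega_in r = {f \<in> class_A. \<forall>z. norm z < r \<longrightarrow> norm (z * deriv f z - f z) < 1 / 2}"

definition subordinate :: "(complex \<Rightarrow> complex) \<Rightarrow> (complex \<Rightarrow> complex) \<Rightarrow> bool" where
  "subordinate p \<phi> \<longleftrightarrow>
     (\<exists>\<omega>. \<omega> holomorphic_on unit_disc \<and> \<omega> ` unit_disc \<subseteq> unit_disc \<and> \<omega> 0 = 0 \<and>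
          (\<forall>z\<in>unit_disc. p z = \<phi> (\<omega> z)))"

(* The function z f'(z) / f(z), with its removable singularity at 0 filled in by its limit 1
   (f 0 = 0 and f'(0) = 1 on class_A). At any other zero of f, HOL's division by zero gives
   the value 0, which csqrt (1 + w) does not take for |w| < 1; so membership in S_star_L
   forces f to have no zero in the disc other than 0. *)
definition log_deriv_quot :: "(complex \<Rightarrow> complex) \<Rightarrow> complex \<Rightarrow> complex" where
  "log_deriv_quot f z = (if z = 0 then 1 else z * deriv f z / f z)"

definition S_star_L :: "(complex \<Rightarrow> complex) set" where
  "S_star_L = {f \<in> class_A. subordinate (log_deriv_quot f) (\<lambda>z. csqrt (1 + z))}"

(* The real equation is meaningful only for r \<le> 1, because of sqrt (1 - r); beyond that,
   HOL's sqrt takes the junk value - sqrt (r - 1). *)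
definition radius_root :: "real \<Rightarrow> bool" where
  "radius_root r \<longleftrightarrow> 0 < r \<and> r \<le> 1 \<and>
     8 * r * (1 - sqrt (1 - r)) * exp (2 * sqrt (1 + r) - 2) - (1 + sqrt (1 + r))\<^sup>2 = 0"

end

theory Submission
  imports Defs
begin

text \<open>
  Write \<open>z f'(z) / f(z) = csqrt (1 + w)\<close>, where \<open>\<bar>w\<bar> \<le> \<bar>z\<bar> = r\<close> by the Schwarz lemma, so that
  \<open>\<bar>z f'(z) - f(z)\<bar> = \<bar>f(z)\<bar> \<bar>csqrt (1 + w) - 1\<bar>\<close>. The second factor is at most
  \<open>1 - sqrt (1 - r)\<close>. Along a ray, the logarithmic derivative of \<open>\<bar>f\<bar>\<close> is
  \<open>Re (csqrt (1 + w)) / r \<le> sqrt (1 + r) / r\<close>, which gives \<open>\<bar>f(z)\<bar> \<le> growth r\<close>. The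
  product of the two bounds increases with \<open>r\<close> and equals \<open>1 / 2\<close> exactly at the root of the
  given equation.
\<close>

section \<open>The growth function and the root equation\<close>

text \<open>
  The extremal function of the class, i.e. the solution of \<open>r g'(r) / g(r) = sqrt (1 + r)\<close>
  with \<open>g(r) / r \<rightarrow> 1\<close> as \<open>r \<rightarrow> 0\<close>.
\<close>
definition growth :: "real \<Rightarrow> real" where
  "growth r = 4 * r * exp (2 * sqrt (1 + r) - 2) / (1 + sqrt (1 + r))\<^sup>2"

lemma growth_pos: "0 < r \<Longrightarrow> 0 < growth r"
  unfolding growth_def by (intro divide_pos_pos mult_pos_pos zero_less_power) (auto simp: add_pos_pos)

text \<open>With \<open>s = sqrt (1 + r)\<close>, the factorization
  \<open>r = (s - 1) * (s + 1)\<close> cancels one factor \<open>1 + s\<close>. Both remaining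
  factors increase with \<open>s\<close>, which serves monotonicity and numerical
  evaluation.\<close>

lemma growth_alt:
  assumes "0 \<le> r"
  shows "growth r = 4 * exp (2 * sqrt (1 + r) - 2) * (1 - 2 / (1 + sqrt (1 + r)))"
proof -
  define s where "s = sqrt (1 + r)"
  have s: "s \<ge> 1" "r = (s - 1) * (s + 1)"
    using assms by (auto simp: s_def algebra_simps)
  show ?thesis
    unfolding growth_def s_def[symmetric] using s(1)
    by (simp add: s(2) divide_simps) (simp add: algebra_simps power2_eq_square)
qed

lemma growth_strict_mono:
  assumes "0 \<le> r" "r < r'"
  shows "growth r < growth r'"
proof -
  have s: "1 \<le> sqrt (1 + r)" "sqrt (1 + r) < sqrt (1 + r')"
    using assms by auto
  then have "2 / (1 + sqrt (1 + r')) < 2 / (1 + sqrt (1 + r))"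
    by (intro divide_strict_left_mono mult_pos_pos) linarith+
  moreover have "2 / (1 + sqrt (1 + r)) \<le> 1"
    using s(1) by (subst divide_le_eq_1_pos) linarith+
  moreover have "exp (2 * sqrt (1 + r) - 2) < exp (2 * sqrt (1 + r') - 2)"
    using s by simp
  ultimately show ?thesis
    using assms by (simp add: growth_alt mult_strict_mono)
qed

lemma growth_has_real_derivative:
  assumes "0 < t"
  shows "(growth has_real_derivative growth t * (sqrt (1 + t) / t)) (at t)"
proof -
  define s where "s = sqrt (1 + t)"
  have s: "s > 1" "t = (s - 1) * (s + 1)"
    using assms by (auto simp: s_def algebra_simps)
  have "((\<lambda>r. 4 * exp (2 * sqrt (1 + r) - 2) * (1 - 2 / (1 + sqrt (1 + r)))) has_real_derivative
      4 * exp (2 * s - 2) * (1 - 2 / (1 + s)) / s + 4 * exp (2 * s - 2) / (s * (1 + s)\<^sup>2)) (at t)"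
    unfolding s_def using assms s(1)
    by (auto intro!: derivative_eq_intros simp: s_def[symmetric])
      (simp add: divide_simps, simp add: algebra_simps power2_eq_square)
  also have "4 * exp (2 * s - 2) * (1 - 2 / (1 + s)) / s + 4 * exp (2 * s - 2) / (s * (1 + s)\<^sup>2)
      = growth t * (s / t)"
    unfolding growth_def s_def[symmetric] using s(1)
    by (simp add: s(2) divide_simps) (simp add: algebra_simps power2_eq_square)
  finally have "((\<lambda>r. 4 * exp (2 * sqrt (1 + r) - 2) * (1 - 2 / (1 + sqrt (1 + r)))) has_real_derivative
      growth t * (sqrt (1 + t) / t)) (at t)"
    by (simp add: s_def)
  \<comment> \<open>\<open>growth_alt\<close> needs a nonnegative argument, so the two formulas are
    compared only near \<open>t\<close>, which is enough for the derivative.\<close>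
  moreover have "\<forall>\<^sub>F r in nhds t. 0 < r"
    using assms by (rule eventually_nhds_in_open[of "{0<..}", simplified, rotated -1]) simp_all
  then have "\<forall>\<^sub>F r in nhds t.
      4 * exp (2 * sqrt (1 + r) - 2) * (1 - 2 / (1 + sqrt (1 + r))) = growth r"
    by eventually_elim (simp add: growth_alt)
  ultimately show ?thesis
    by (simp add: DERIV_cong_ev)
qed

text \<open>Divide the equation by twice the nonzero square of
  \<open>1 + sqrt (1 + r)\<close>.\<close>

lemma radius_root_iff_growth:
  "radius_root r \<longleftrightarrow> 0 < r \<and> r \<le> 1 \<and> growth r * (1 - sqrt (1 - r)) = 1 / 2"
proof (cases "0 < r")
  case True
  then have "(1 + sqrt (1 + r))\<^sup>2 \<noteq> 0"
    by (smt (verit) real_sqrt_ge_zero zero_eq_power2)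
  then show ?thesis
    unfolding radius_root_def growth_def by (auto simp: field_simps)
qed (simp add: radius_root_def)

lemma growth_mult_strict_mono:
  assumes "0 \<le> r" "r < r'" "r' \<le> 1"
  shows "growth r * (1 - sqrt (1 - r)) < growth r' * (1 - sqrt (1 - r'))"
proof (intro mult_strict_mono')
  show "growth r < growth r'" "0 \<le> growth r"
    using growth_strict_mono assms growth_pos[of r] by (auto simp: growth_def)
qed (use assms in auto)

section \<open>Pointwise estimates for the class\<close>

text \<open>With \<open>q = csqrt (1 + w)\<close>, the product \<open>(q - 1) * (q + 1)\<close> is
  \<open>w\<close>. The principal branch keeps \<open>Re q\<close> at least
  \<open>s = sqrt (1 - r)\<close>, so the second factor has modulus at least \<open>1 + s\<close>,
  while \<open>r = (1 - s) * (1 + s)\<close>.\<close>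

lemma csqrt_minus_one_bound:
  assumes "cmod w \<le> r" "r \<le> 1"
  shows "cmod (csqrt (1 + w) - 1) \<le> 1 - sqrt (1 - r)"
proof -
  define q where "q = csqrt (1 + w)"
  define s where "s = sqrt (1 - r)"
  have s: "s \<ge> 0" "r = (1 - s) * (1 + s)"
    using assms by (auto simp: s_def algebra_simps)
  have "1 - r \<le> Re (q\<^sup>2)"
    using assms abs_Re_le_cmod[of w] by (simp add: q_def)
  also have "\<dots> \<le> (Re q)\<^sup>2"
    by (simp add: power2_eq_square)
  finally have "s \<le> Re q"
    unfolding s_def q_def by (meson Re_csqrt real_le_lsqrt real_sqrt_le_iff
        real_sqrt_unique order_trans real_sqrt_le_mono abs_of_nonneg eq_refl)
  then have "1 + s \<le> cmod (q + 1)"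
    using complex_Re_le_cmod[of "q + 1"] by simp
  then have "cmod (q - 1) * (1 + s) \<le> cmod (q - 1) * cmod (q + 1)"
    by (simp add: mult_left_mono)
  also have "\<dots> = cmod (q\<^sup>2 - 1)"
    by (simp add: norm_mult[symmetric] power2_eq_square algebra_simps)
  also have "\<dots> \<le> (1 - s) * (1 + s)"
    using assms(1) s(2) by (simp add: q_def)
  finally have "cmod (q - 1) \<le> 1 - s"
    by (rule mult_right_le_imp_le) (use s(1) in simp)
  then show ?thesis
    by (simp add: q_def s_def)
qed

lemma S_star_L_quotient:
  assumes "f \<in> S_star_L" "cmod z < 1" "z \<noteq> 0"
  obtains w where "cmod w \<le> cmod z" "z * deriv f z = f z * csqrt (1 + w)" "f z \<noteq> 0"
proof -
  obtain \<omega> where \<omega>: "\<omega> holomorphic_on unit_disc" "\<omega> ` unit_disc \<subseteq> unit_disc" "\<omega> 0 = 0"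
    and eq: "\<And>z. z \<in> unit_disc \<Longrightarrow> log_deriv_quot f z = csqrt (1 + \<omega> z)"
    using assms(1) unfolding S_star_L_def subordinate_def by blast
  have le: "cmod (\<omega> z) \<le> cmod z"
    using \<omega> assms(2) by (intro Schwarz_Lemma(1)) (auto simp: image_subset_iff)
  have *: "z * deriv f z / f z = csqrt (1 + \<omega> z)"
    using eq[of z] assms by (simp add: log_deriv_quot_def)
  \<comment> \<open>If \<open>f z\<close> were 0, division by zero would make the quotient 0 and
    force \<open>\<omega> z = -1\<close>, against
    \<open>cmod (\<omega> z) \<le> cmod z < 1\<close>.\<close>
  have "1 + \<omega> z \<noteq> 0"
  proof
    assume "1 + \<omega> z = 0"
    then have "\<omega> z = -1"
      by (simp add: add_eq_0_iff)
    then show False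
      using le assms by simp
  qed
  then have "f z \<noteq> 0"
    using * by auto
  with le * that[of "\<omega> z"] show ?thesis
    by (simp add: field_simps)
qed

lemma S_star_L_growth:
  assumes f: "f \<in> S_star_L" and z: "cmod z < 1" "z \<noteq> 0"
  shows "cmod (f z) \<le> growth (cmod z)"
proof -
  define u where "u = sgn z"
  define r where "r = cmod z"
  have r: "0 < r" "r < 1" and u: "cmod u = 1" and zu: "z = of_real r * u"
    using z by (auto simp: u_def r_def norm_sgn) (simp add: sgn_eq)
  have hol: "f holomorphic_on unit_disc" and f0: "f 0 = 0" "deriv f 0 = 1"
    using f by (auto simp: S_star_L_def class_A_def)
  define F where "F t = f (of_real t * u)" for t :: real
  \<comment> \<open>The squared modulus is a polynomial in real and imaginary parts, so no norm has
    to be differentiated.\<close>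
  define N where "N t = (Re (F t))\<^sup>2 + (Im (F t))\<^sup>2" for t
  define Q where "Q t = N t / (growth t)\<^sup>2" for t
  \<comment> \<open>\<open>Q\<close> decreases along the ray and tends to \<open>1\<close> at \<open>0\<close>.\<close>
  have dQ: "\<exists>y. DERIV Q t :> y \<and> y \<le> 0" if t: "0 < t" "t < 1" for t
  proof -
    have tu: "cmod (of_real t * u) = t" and tu0: "of_real t * u \<noteq> 0"
      using t u by (auto simp: norm_mult)
    obtain w where w: "cmod w \<le> t" "of_real t * u * deriv f (of_real t * u) = F t * csqrt (1 + w)"
      using S_star_L_quotient[OF f _ tu0] tu t(2) unfolding F_def by metis
    define p where "p = csqrt (1 + w)"
    define D where "D = u * deriv f (of_real t * u)"
    have D: "D = F t * p / of_real t"
      using w(2) t by (simp add: D_def p_def field_simps)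
    have "(f has_field_derivative deriv f (of_real t * u)) (at (of_real t * u))"
      using hol tu t by (intro holomorphic_derivI[of _ unit_disc]) auto
    moreover have "((\<lambda>t. of_real t * u) has_vector_derivative u) (at t)"
      by (auto intro!: derivative_eq_intros)
    ultimately have vd: "(F has_vector_derivative D) (at t)"
      using field_vector_diff_chain_at[of "\<lambda>t. of_real t * u" u t f "deriv f (of_real t * u)"]
      by (simp add: F_def[abs_def] o_def D_def)
    have "((\<lambda>t. Re (F t)) has_real_derivative Re D) (at t)"
      "((\<lambda>t. Im (F t)) has_real_derivative Im D) (at t)"
      using bounded_linear.has_vector_derivative[OF bounded_linear_Re vd]
        bounded_linear.has_vector_derivative[OF bounded_linear_Im vd]
      by (simp_all add: has_real_derivative_iff_has_vector_derivative)
    with vd have "(N has_real_derivative 2 * (Re (F t) * Re D + Im (F t) * Im D)) (at t)"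
      unfolding N_def[abs_def] by (auto intro!: derivative_eq_intros simp: algebra_simps)
    \<comment> \<open>The bracket is the real part of \<open>cnj (F t) * D\<close>, and
      \<open>D = F t * p / t\<close>.\<close>
    moreover have "2 * (Re (F t) * Re D + Im (F t) * Im D) = 2 * N t * Re p / t"
      using t by (simp add: D N_def field_simps power2_eq_square)
    ultimately have dN: "(N has_real_derivative 2 * N t * Re p / t) (at t)"
      by simp
    have g: "growth t > 0"
      using growth_pos t by simp
    have "(Q has_real_derivative Q t * (2 / t) * (Re p - sqrt (1 + t))) (at t)"
      unfolding Q_def[abs_def] using g t
      by (auto intro!: derivative_eq_intros dN growth_has_real_derivative
          simp: field_simps power2_eq_square power4_eq_xxxx)
    moreover have "Re p \<le> sqrt (1 + t)"
    proof -
      have "Re p \<le> cmod p"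
        by (rule complex_Re_le_cmod)
      also have "cmod p \<le> sqrt (1 + t)"
        using norm_triangle_ineq[of 1 w] w(1) by (simp add: p_def)
      finally show ?thesis .
    qed
    then have "Q t * (2 / t) * (Re p - sqrt (1 + t)) \<le> 0"
      using t by (intro mult_nonneg_nonpos) (auto simp: Q_def N_def)
    ultimately show ?thesis
      by blast
  qed
  have "Q r \<le> Q t" if "0 < t" "t \<le> r" for t
    using that r by (intro DERIV_nonpos_imp_nonincreasing[of t r Q] dQ) auto
  then have ev: "\<forall>\<^sub>F t in at_right 0. Q r \<le> Q t"
    using r(1) by (auto simp: eventually_at_right_field intro!: exI[of _ r])
  have "(f has_field_derivative 1) (at 0)"
    using holomorphic_derivI[OF hol, of 0] f0 by simp
  then have "((\<lambda>h. f h / h) \<longlongrightarrow> 1) (at 0)"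
    by (simp add: DERIV_def f0)
  moreover have "filterlim (\<lambda>t. of_real t * u) (at 0) (at_right 0)"
  proof -
    have "u \<noteq> 0"
      using u by auto
    then show ?thesis
      unfolding filterlim_at
      by (auto intro!: tendsto_eq_intros exI[of _ 1] simp: eventually_at_right_field)
  qed
  ultimately have "((\<lambda>t. f (of_real t * u) / (of_real t * u)) \<longlongrightarrow> 1) (at_right 0)"
    by (rule filterlim_compose)
  then have limF: "((\<lambda>t. (cmod (f (of_real t * u) / (of_real t * u)))\<^sup>2) \<longlongrightarrow> 1) (at_right 0)"
    using tendsto_power[OF tendsto_norm, of _ 1 "at_right 0" 2] by force
  \<comment> \<open>This is \<open>growth t / t\<close>. Dividing numerator and denominator of
    \<open>Q t\<close> by the square of \<open>t\<close> removes the form 0/0 at 0.\<close>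
  have limg: "((\<lambda>t. 4 * exp (2 * sqrt (1 + t) - 2) / (1 + sqrt (1 + t))\<^sup>2) \<longlongrightarrow> 1) (at_right 0)"
    by (auto intro!: tendsto_eq_intros)
  have "((\<lambda>t. (cmod (f (of_real t * u) / (of_real t * u)))\<^sup>2 /
      (4 * exp (2 * sqrt (1 + t) - 2) / (1 + sqrt (1 + t))\<^sup>2)\<^sup>2) \<longlongrightarrow> 1) (at_right 0)"
    using tendsto_divide[OF limF tendsto_power[OF limg, of 2]] by simp
  moreover have "\<forall>\<^sub>F t in at_right 0. (cmod (f (of_real t * u) / (of_real t * u)))\<^sup>2 /
      (4 * exp (2 * sqrt (1 + t) - 2) / (1 + sqrt (1 + t))\<^sup>2)\<^sup>2 = Q t"
    unfolding eventually_at_right_field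
    by (rule exI[of _ 1])
      (simp add: Q_def N_def F_def cmod_power2[symmetric] growth_def norm_divide norm_mult u
        power_divide power_mult_distrib)
  ultimately have "(Q \<longlongrightarrow> 1) (at_right 0)"
    by (rule Lim_transform_eventually)
  then have "Q r \<le> 1"
    using ev by (rule tendsto_lowerbound) simp
  moreover have "N r = (cmod (f z))\<^sup>2"
    by (simp add: N_def F_def zu cmod_power2)
  ultimately have "(cmod (f z))\<^sup>2 \<le> (growth r)\<^sup>2"
    using growth_pos[OF r(1)] by (simp add: Q_def)
  then show ?thesis
    using growth_pos[OF r(1)] by (simp add: r_def power2_le_iff_abs_le)
qed

lemma S_star_L_bound:
  assumes "f \<in> S_star_L" "cmod z < 1"
  shows "cmod (z * deriv f z - f z) \<le> growth (cmod z) * (1 - sqrt (1 - cmod z))"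
proof (cases "z = 0")
  case True
  then show ?thesis
    using assms by (simp add: S_star_L_def class_A_def)
next
  case False
  obtain w where w: "cmod w \<le> cmod z" "z * deriv f z = f z * csqrt (1 + w)"
    using S_star_L_quotient assms False by metis
  have "z * deriv f z - f z = f z * (csqrt (1 + w) - 1)"
    using w(2) by (simp add: algebra_simps)
  then have "cmod (z * deriv f z - f z) = cmod (f z) * cmod (csqrt (1 + w) - 1)"
    by (simp only: norm_mult)
  also have "\<dots> \<le> growth (cmod z) * (1 - sqrt (1 - cmod z))"
    using S_star_L_growth[OF assms False] csqrt_minus_one_bound[OF w(1)] assms(2) False
    by (intro mult_mono) (auto simp: growth_pos less_imp_le)
  finally show ?thesis .
qed

section \<open>Numerical enclosure of the root\<close>

text \<open>For even \<open>n\<close> the Lagrange remainder is nonnegative whatever the sign of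
  \<open>x\<close>. Negative \<open>x\<close> thus yields upper bounds for \<open>exp\<close> by
  taking reciprocals.\<close>

lemma exp_ge_Taylor_even:
  fixes x :: real
  assumes "even n"
  shows "(\<Sum>m<n. x ^ m / fact m) \<le> exp x"
proof -
  obtain t where "exp x = (\<Sum>m<n. x ^ m / fact m) + exp t / fact n * x ^ n"
    using Maclaurin_exp_le by blast
  moreover have "0 \<le> exp t / fact n * x ^ n"
    using assms by (simp add: zero_le_even_power)
  ultimately show ?thesis
    by linarith
qed

text \<open>The argument lies 0.0000004 below 0.734453, inside the required tolerance;
  \<open>growth_mult_upper\<close> uses the mirror point above.\<close>

lemma growth_mult_lower: "growth 0.7344526 * (1 - sqrt (1 - 0.7344526)) < 1 / 2"
proof -
  define s :: real where "s = sqrt (1 + 0.7344526)"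
  define q :: real where "q = sqrt (1 - 0.7344526)"
  have "s \<le> 1.3169862"
    unfolding s_def by (rule real_le_lsqrt) (simp_all add: power2_eq_square)
  then have s: "1 \<le> s" "s \<le> 1.3169862"
    by (simp_all add: s_def)
  have "0.5153129 \<le> q"
    unfolding q_def by (rule real_le_rsqrt) (simp add: power2_eq_square)
  then have q: "0.5153129 \<le> q" "q \<le> 1"
    by (simp_all add: q_def)
  \<comment> \<open>The number 0.6339724 is \<open>2 * s - 2\<close> at the upper bound 1.3169862
    for \<open>s\<close>. The negated exponent turns a lower Taylor bound into an upper bound for
    \<open>exp\<close>.\<close>
  have "0.5304803 \<le> (\<Sum>m<10. (- 0.6339724 :: real) ^ m / fact m)"
    by (simp add: eval_nat_numeral)
  also have "\<dots> \<le> exp (- 0.6339724)"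
    by (rule exp_ge_Taylor_even) simp
  finally have "exp 0.6339724 \<le> 1 / (0.5304803 :: real)"
    by (simp add: exp_minus field_simps)
  moreover have "exp (2 * s - 2) \<le> exp 0.6339724"
    using s(2) by simp
  ultimately have e: "exp (2 * s - 2) \<le> 1 / 0.5304803"
    by linarith
  have "2 / 2.3169862 \<le> 2 / (1 + s)"
    using s by (intro divide_left_mono) auto
  then have "4 * exp (2 * s - 2) * (1 - 2 / (1 + s)) * (1 - q)
      \<le> 4 * (1 / 0.5304803) * (1 - 2 / 2.3169862) * (1 - 0.5153129)"
    using s q e by (intro mult_mono mult_nonneg_nonneg) auto
  also have "\<dots> < 1 / 2"
    by simp
  finally show ?thesis
    by (simp add: growth_alt s_def q_def)
qed

lemma growth_mult_upper: "1 / 2 < growth 0.7344534 * (1 - sqrt (1 - 0.7344534))"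
proof -
  define s :: real where "s = sqrt (1 + 0.7344534)"
  define q :: real where "q = sqrt (1 - 0.7344534)"
  have s: "1.31698648 \<le> s"
    unfolding s_def by (rule real_le_rsqrt) (simp add: power2_eq_square)
  have q: "q \<le> 0.51531214"
    unfolding q_def by (rule real_le_lsqrt) (simp_all add: power2_eq_square)
  \<comment> \<open>Here 0.63397296 is \<open>2 * s - 2\<close> at the lower bound 1.31698648 for
    \<open>s\<close>.\<close>
  have "1.885085 \<le> (\<Sum>m<10. (0.63397296 :: real) ^ m / fact m)"
    by (simp add: eval_nat_numeral)
  also have "\<dots> \<le> exp 0.63397296"
    by (rule exp_ge_Taylor_even) simp
  also have "\<dots> \<le> exp (2 * s - 2)"
    using s by simp
  finally have e: "1.885085 \<le> exp (2 * s - 2)" .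
  have "1 / 2 < 4 * 1.885085 * (1 - 2 / 2.31698648) * (1 - 0.51531214 :: real)"
    by simp
  also have "2 / (1 + s) \<le> 2 / 2.31698648"
    using s by (intro divide_left_mono) auto
  then have "4 * 1.885085 * (1 - 2 / 2.31698648) * (1 - 0.51531214)
      \<le> 4 * exp (2 * s - 2) * (1 - 2 / (1 + s)) * (1 - q)"
    using s q e by (intro mult_mono mult_nonneg_nonneg) auto
  finally show ?thesis
    by (simp add: growth_alt s_def q_def)
qed

section \<open>Existence and uniqueness of the root, and the inequality in the disc\<close>

theorem theorem2p19:
  shows "\<exists>r0. radius_root r0 \<and> (\<forall>r. radius_root r \<longrightarrow> r = r0)
           \<and> \<bar>r0 - 0.734453\<bar> < 0.0000005
           \<and> (\<forall>f \<in> S_star_L. f \<in> Omega_in r0)"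
proof -
  define H where "H r = growth r * (1 - sqrt (1 - r))" for r
  have mono: "H r < H r'" if "0 \<le> r" "r < r'" "r' \<le> 1" for r r'
    unfolding H_def using that by (rule growth_mult_strict_mono)
  have "continuous_on {0.7344526..0.7344534} H"
  proof -
    have "1 + sqrt (1 + r) \<noteq> 0" if "0 \<le> r" for r :: real
      using that by (smt (verit) real_sqrt_ge_zero)
    then show ?thesis
      unfolding H_def[abs_def] growth_def[abs_def] by (auto intro!: continuous_intros)
  qed
  \<comment> \<open>The intermediate value theorem between the two numerical estimates gives
    existence and the decimal enclosure together.\<close>
  then obtain r0 where r0: "0.7344526 \<le> r0" "r0 \<le> 0.7344534" "H r0 = 1 / 2"
    using IVT'[of H "0.7344526" "1/2" "0.7344534"] growth_mult_lower growth_mult_upper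
    unfolding H_def by force
  have root: "radius_root r \<longleftrightarrow> 0 < r \<and> r \<le> 1 \<and> H r = 1 / 2" for r
    by (simp add: radius_root_iff_growth H_def)
  have "r = r0" if "radius_root r" for r
  proof (rule ccontr)
    assume "r \<noteq> r0"
    then consider "r < r0" | "r0 < r"
      by linarith
    then show False
      using mono[of r r0] mono[of r0 r] that r0 by cases (auto simp: root)
  qed
  moreover have "f \<in> Omega_in r0" if f: "f \<in> S_star_L" for f
  proof -
    have "cmod (z * deriv f z - f z) < 1 / 2" if z: "cmod z < r0" for z
    proof -
      have "cmod (z * deriv f z - f z) \<le> H (cmod z)"
        unfolding H_def using S_star_L_bound[OF f] z r0 by simp
      \<comment> \<open>Strict monotonicity of \<open>H\<close> supplies the strict
        inequality.\<close>
      also have "\<dots> < H r0"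
        using z r0 by (intro mono) auto
      finally show ?thesis
        using r0 by simp
    qed
    then show ?thesis
      using f by (simp add: Omega_in_def S_star_L_def)
  qed
  moreover have "radius_root r0" "\<bar>r0 - 0.734453\<bar> < 0.0000005"
    using r0 unfolding root abs_less_iff by auto
  ultimately show ?thesis
    by blast
qed

end
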